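(* Let $\mathcal{A}$ be a Hopf $^*$-algebra, let $\alpha:\mathcal{A}\to\mathcal{A}$ be an admissible bijection, put $\gamma:=\mathrm{id}+\alpha:\mathcal{A}\to\mathcal{A}$ and $S_\alpha:=S\circ\alpha$, and let $\eta:\mathcal{A}\to D$ be an $\alpha$-real cocycle on $\mathcal{A}$. Then the formula $$L(\gamma(a)) = -\langle \eta(S_\alpha(a_{(1)})^* ),\eta(\alpha(a_{(2)}))\rangle = -\langle \eta(\alpha(a_{(1)})^* ),\eta(S_\alpha(a_{(2)}))\rangle,\qquad a\in\mathcal{A},$$ defines an $S_\alpha$-invariant generating functional $L:\mathcal{A}\to\mathbb{C}$ such that $\eta$ yields the coboundary of $L$.
   Context: Inner products are linear in the second variable. $\mathcal{A}$ is a Hopf $^*$-algebra over $\mathbb{C}$ with coproduct $\Delta$, counit $\epsilon$, antipode $S$; Sweedler notation $\Delta(a)=a_{(1)}\otimes a_{(2)}$ is used; $K_1=\ker\epsilon$. Admissible bijection: a map $\alpha:\mathcal{A}\to\mathcal{A}$ such that (i) $\alpha$ is an algebra homomorphism; (ii) $\alpha\circ{}^*\circ\alpha\circ{}^*=\mathrm{id}$; (iii) $(\alpha\otimes\alpha)\circ\Delta=\Delta\circ\alpha$; (iv) the linear map $\mathrm{id}+\alpha:\mathcal{A}\to\mathcal{A}$ is a bijection; (v) the linear map $\mathrm{id}\otimes\mathrm{id}+\alpha\otimes\alpha:\mathcal{A}\otimes\mathcal{A}\to\mathcal{A}\otimes\mathcal{A}$ is a bijection. Representation of $\mathcal{A}$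 on a pre-Hilbert space $D$: a unital $^*$-homomorphism from $\mathcal{A}$ to $\mathcal{L}^\dagger(D)$, the $^*$-algebra of linear operators $D\to D$ having an adjoint that is defined on $D$ and maps $D$ into $D$. Cocycle: a linear map $\eta:\mathcal{A}\to D$ ($D$ a pre-Hilbert space) for which there is a representation $\pi$ of $\mathcal{A}$ on $D$ with $\eta(ab)=\pi(a)\eta(b)+\eta(a)\epsilon(b)$ for all $a,b\in\mathcal{A}$, and such that $\eta(\mathcal{A})$ is dense in $D$. The cocycle $\eta$ is $\alpha$-real if $\langle\eta(a),\eta(b)\rangle=\langle\eta(S_\alpha(b)^* ),\eta(S_\alpha(a^* ))\rangle$ for all $a,b\in\mathcal{A}$. Generating functional: a linear functional $L:\mathcal{A}\to\mathbb{C}$ with $L(a^*a)\ge 0$ for $a\in K_1$, $L(b^* )=\overline{L(b)}$ for $b\in\mathcal{A}$, and $L(1)=0$. It is $S_\alpha$-invariant if $L\circ S_\alpha=L$. $\eta$ yields the coboundary of $L$ if $L(ab)=\epsilon(a)L(b)+L(a)\epsilon(b)+\langle\eta(a^* ),\eta(b)\rangle$ for all $a,b\in\mathcal{A}$. *)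

theory Defs
  imports "HOL-Analysis.Analysis" "HOL-Library.Poly_Mapping" "HOL-Library.Nonpos_Ints"
begin

section \<open>Complex vector spaces\<close>

class complex_vector = ab_group_add +
  fixes scaleC :: "complex \<Rightarrow> 'a \<Rightarrow> 'a" (infixr \<open>*\<^sub>C\<close> 75)
  assumes scaleC_add_right: "c *\<^sub>C (x + y) = c *\<^sub>C x + c *\<^sub>C y"
    and scaleC_add_left: "(c + d) *\<^sub>C x = c *\<^sub>C x + d *\<^sub>C x"
    and scaleC_scaleC [simp]: "c *\<^sub>C d *\<^sub>C x = (c * d) *\<^sub>C x"
    and scaleC_one [simp]: "1 *\<^sub>C x = x"

interpretation complex_vector: vector_space "scaleC :: complex \<Rightarrow> 'a \<Rightarrow> 'a::complex_vector"
  by standard (simp_all add: scaleC_add_right scaleC_add_left)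

declare complex_vector.scale_zero_left [simp] complex_vector.scale_zero_right [simp]

abbreviation clinear :: "('a::complex_vector \<Rightarrow> 'b::complex_vector) \<Rightarrow> bool"
  where "clinear \<equiv> Vector_Spaces.linear scaleC scaleC"

lemma clinear_iff: "clinear f \<longleftrightarrow> (\<forall>x y. f (x + y) = f x + f y) \<and> (\<forall>c x. f (c *\<^sub>C x) = c *\<^sub>C f x)"
  by (simp add: Vector_Spaces.linear_iff complex_vector.vector_space_axioms)

lemma clinearI:
  assumes "\<And>x y. f (x + y) = f x + f y" "\<And>c x. f (c *\<^sub>C x) = c *\<^sub>C f x"
  shows "clinear f"
  using assms by (simp add: clinear_iff)

lemma clinear_add: "clinear f \<Longrightarrow> f (x + y) = f x + f y"
  by (simp add: clinear_iff)

lemma clinear_scaleC: "clinear f \<Longrightarrow> f (c *\<^sub>C x) = c *\<^sub>C f x"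
  by (simp add: clinear_iff)

lemma clinear_zero: "clinear f \<Longrightarrow> f 0 = 0"
  by (metis clinear_scaleC complex_vector.scale_zero_left)

instantiation complex :: complex_vector
begin
definition scaleC_complex :: "complex \<Rightarrow> complex \<Rightarrow> complex"
  where [simp]: "scaleC_complex c x = c * x"
instance by standard (simp_all add: algebra_simps)
end

definition cbilinear :: "('a::complex_vector \<Rightarrow> 'b::complex_vector \<Rightarrow> 'c::complex_vector) \<Rightarrow> bool"
  where "cbilinear f \<longleftrightarrow> (\<forall>x. clinear (f x)) \<and> (\<forall>y. clinear (\<lambda>x. f x y))"


section \<open>Algebraic tensor product\<close>

text \<open>
  The tensor product is the free complex vector space on pairs modulo the bilinearity
  relations. Elements of the free space are finitely supported functions.
\<close>

definition free_scale :: "complex \<Rightarrow> ('k \<Rightarrow>\<^sub>0 complex) \<Rightarrow> ('k \<Rightarrow>\<^sub>0 complex)"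
  where "free_scale c p = Poly_Mapping.map ((*) c) p"

lemma lookup_free_scale [simp]: "Poly_Mapping.lookup (free_scale c p) k = c * Poly_Mapping.lookup p k"
  by (simp add: free_scale_def Poly_Mapping.map.rep_eq when_def)

interpretation free: vector_space "free_scale :: complex \<Rightarrow> ('k \<Rightarrow>\<^sub>0 complex) \<Rightarrow> _"
  by standard (auto intro!: poly_mapping_eqI simp: lookup_add algebra_simps)

definition tensor_relators :: "('a::complex_vector \<times> 'b::complex_vector \<Rightarrow>\<^sub>0 complex) set"
  where "tensor_relators =
    {Poly_Mapping.single (x + x', y) 1 - Poly_Mapping.single (x, y) 1 - Poly_Mapping.single (x', y) 1 |x x' y. True} \<union>
    {Poly_Mapping.single (x, y + y') 1 - Poly_Mapping.single (x, y) 1 - Poly_Mapping.single (x, y') 1 |x y y'. True} \<union>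
    {Poly_Mapping.single (c *\<^sub>C x, y) 1 - Poly_Mapping.single (x, y) c |c x y. True} \<union>
    {Poly_Mapping.single (x, c *\<^sub>C y) 1 - Poly_Mapping.single (x, y) c |c x y. True}"

definition tensor_rel :: "('a::complex_vector \<times> 'b::complex_vector \<Rightarrow>\<^sub>0 complex) \<Rightarrow> _ \<Rightarrow> bool"
  where "tensor_rel p q \<longleftrightarrow> p - q \<in> free.span tensor_relators"

lemma equivp_tensor_rel:
  "equivp (tensor_rel :: ('a::complex_vector \<times> 'b::complex_vector \<Rightarrow>\<^sub>0 complex) \<Rightarrow> _)"
proof (rule equivpI)
  show "reflp (tensor_rel :: ('a \<times> 'b \<Rightarrow>\<^sub>0 complex) \<Rightarrow> _)"
    by (simp add: reflp_def tensor_rel_def free.span_zero)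
  show "symp (tensor_rel :: ('a \<times> 'b \<Rightarrow>\<^sub>0 complex) \<Rightarrow> _)"
  proof (rule sympI)
    fix p q :: "'a \<times> 'b \<Rightarrow>\<^sub>0 complex"
    assume "tensor_rel p q"
    then have "- (p - q) \<in> free.span tensor_relators"
      unfolding tensor_rel_def by (rule free.span_neg)
    then show "tensor_rel q p"
      unfolding tensor_rel_def by (simp only: minus_diff_eq)
  qed
  show "transp (tensor_rel :: ('a \<times> 'b \<Rightarrow>\<^sub>0 complex) \<Rightarrow> _)"
  proof (rule transpI)
    fix p q r :: "'a \<times> 'b \<Rightarrow>\<^sub>0 complex"
    assume "tensor_rel p q" "tensor_rel q r"
    then have "(p - q) + (q - r) \<in> free.span tensor_relators"
      unfolding tensor_rel_def by (rule free.span_add)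
    then show "tensor_rel p r"
      unfolding tensor_rel_def by simp
  qed
qed

quotient_type (overloaded) ('a, 'b) tensor =
  "'a::complex_vector \<times> 'b::complex_vector \<Rightarrow>\<^sub>0 complex" / tensor_rel
  by (rule equivp_tensor_rel)

instantiation tensor :: (complex_vector, complex_vector) complex_vector
begin
lift_definition zero_tensor :: "('a, 'b) tensor" is 0 .

lift_definition plus_tensor :: "('a, 'b) tensor \<Rightarrow> ('a, 'b) tensor \<Rightarrow> ('a, 'b) tensor" is "(+)"
  unfolding tensor_rel_def add_diff_add by (rule free.span_add)

lift_definition minus_tensor :: "('a, 'b) tensor \<Rightarrow> ('a, 'b) tensor \<Rightarrow> ('a, 'b) tensor" is "(-)"
proof -
  fix p p' q q' :: "'a \<times> 'b \<Rightarrow>\<^sub>0 complex"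
  assume "tensor_rel p p'" "tensor_rel q q'"
  then have "(p - p') - (q - q') \<in> free.span tensor_relators"
    unfolding tensor_rel_def by (rule free.span_diff)
  also have "(p - p') - (q - q') = (p - q) - (p' - q')"
    by (simp only: diff_conv_add_uminus minus_add_distrib minus_minus ac_simps)
  finally show "tensor_rel (p - q) (p' - q')"
    unfolding tensor_rel_def .
qed

lift_definition uminus_tensor :: "('a, 'b) tensor \<Rightarrow> ('a, 'b) tensor" is uminus
proof -
  fix p p' :: "'a \<times> 'b \<Rightarrow>\<^sub>0 complex"
  assume "tensor_rel p p'"
  then have "- (p - p') \<in> free.span tensor_relators"
    unfolding tensor_rel_def by (rule free.span_neg)
  also have "- (p - p') = - p - - p'" by simp
  finally show "tensor_rel (- p) (- p')"
    unfolding tensor_rel_def .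
qed

lift_definition scaleC_tensor :: "complex \<Rightarrow> ('a, 'b) tensor \<Rightarrow> ('a, 'b) tensor" is free_scale
  unfolding tensor_rel_def free.scale_right_diff_distrib[symmetric] by (rule free.span_scale)

instance
proof
  have refl: "p = q \<Longrightarrow> tensor_rel p q" for p q :: "'a \<times> 'b \<Rightarrow>\<^sub>0 complex"
    by (simp add: tensor_rel_def free.span_zero)
  fix s t u :: "('a, 'b) tensor" and c d :: complex
  show "s + t + u = s + (t + u)" by transfer (rule refl, rule add.assoc)
  show "s + t = t + s" by transfer (rule refl, rule add.commute)
  show "0 + s = s" by transfer (rule refl, rule add_0)
  show "- s + s = 0" by transfer (rule refl, rule left_minus)
  show "s - t = s + - t" by transfer (rule refl, rule diff_conv_add_uminus)
  show "c *\<^sub>C (s + t) = c *\<^sub>C s + c *\<^sub>C t" by transfer (rule refl, rule free.scale_right_distrib)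
  show "(c + d) *\<^sub>C s = c *\<^sub>C s + d *\<^sub>C s" by transfer (rule refl, rule free.scale_left_distrib)
  show "c *\<^sub>C d *\<^sub>C s = (c * d) *\<^sub>C s" by transfer (rule refl, rule free.scale_scale)
  show "1 *\<^sub>C s = s" by transfer (rule refl, rule free.scale_one)
qed

end

lift_definition tensor_op :: "'a::complex_vector \<Rightarrow> 'b::complex_vector \<Rightarrow> ('a, 'b) tensor" (infixr \<open>\<otimes>\<close> 78)
  is "\<lambda>x y. Poly_Mapping.single (x, y) 1" .

lemma tensor_add_left: "(x + x') \<otimes> y = x \<otimes> y + x' \<otimes> y"
  by transfer (unfold tensor_rel_def tensor_relators_def diff_diff_eq[symmetric], rule free.span_base, blast)

lemma tensor_add_right: "x \<otimes> (y + y') = x \<otimes> y + x \<otimes> y'"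
  by transfer (unfold tensor_rel_def tensor_relators_def diff_diff_eq[symmetric], rule free.span_base, blast)

lemma free_scale_single [simp]: "free_scale c (Poly_Mapping.single k d) = Poly_Mapping.single k (c * d)"
  by (rule poly_mapping_eqI) (simp add: lookup_single when_def)

lemma tensor_scaleC_left: "(c *\<^sub>C x) \<otimes> y = c *\<^sub>C (x \<otimes> y)"
  by transfer (unfold tensor_rel_def tensor_relators_def free_scale_single mult_1_right, rule free.span_base, blast)

lemma tensor_scaleC_right: "x \<otimes> (c *\<^sub>C y) = c *\<^sub>C (x \<otimes> y)"
  by transfer (unfold tensor_rel_def tensor_relators_def free_scale_single mult_1_right, rule free.span_base, blast)

lemma cbilinear_tensor: "cbilinear (\<otimes>)"
  by (simp add: cbilinear_def clinear_iff tensor_add_left tensor_add_right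
      tensor_scaleC_left tensor_scaleC_right)

lemma tensor_induct [case_names zero add pure]:
  fixes t :: "('a::complex_vector, 'b::complex_vector) tensor"
  assumes zero: "P 0" and add: "\<And>s t. P s \<Longrightarrow> P t \<Longrightarrow> P (s + t)" and pure: "\<And>x y. P (x \<otimes> y)"
  shows "P t"
proof -
  have single: "P (abs_tensor (Poly_Mapping.single k c))" for k :: "'a \<times> 'b" and c
  proof -
    have "abs_tensor (Poly_Mapping.single k c) = c *\<^sub>C (fst k \<otimes> snd k)"
      by (simp add: scaleC_tensor.abs_eq tensor_op.abs_eq)
    then show ?thesis by (metis pure tensor_scaleC_left)
  qed
  have "P (abs_tensor p)" for p :: "'a \<times> 'b \<Rightarrow>\<^sub>0 complex"
  proof (induct p rule: update_induct)
    case const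
    then show ?case using zero by (simp add: zero_tensor_def)
  next
    case (update p k c)
    have "Poly_Mapping.update k c p = p + Poly_Mapping.single k c"
      using update by (intro poly_mapping_eqI)
        (auto simp: lookup_update lookup_add lookup_single when_def in_keys_iff)
    then have "abs_tensor (Poly_Mapping.update k c p) = abs_tensor p + abs_tensor (Poly_Mapping.single k c)"
      by (simp add: plus_tensor.abs_eq)
    then show ?case using add update single by simp
  qed
  then show ?thesis by (metis Quotient_abs_rep[OF Quotient_tensor])
qed

text \<open>
  Extension of a function on pairs to the free vector space, linear for \<open>\<sigma> = (\<lambda>c. c)\<close> and
  conjugate-linear for \<open>\<sigma> = cnj\<close>. It passes to the quotient precisely for suitably
  (conjugate-)bilinear functions; on other functions its value on a representative is junk.
\<close>

definition free_extend :: "(complex \<Rightarrow> complex) \<Rightarrow> ('k \<Rightarrow> 'c::complex_vector) \<Rightarrow> ('k \<Rightarrow>\<^sub>0 complex) \<Rightarrow> 'c"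
  where "free_extend \<sigma> f p = (\<Sum>k\<in>Poly_Mapping.keys p. \<sigma> (Poly_Mapping.lookup p k) *\<^sub>C f k)"

lemma free_extend_superset:
  assumes "\<sigma> 0 = 0" "finite K" "Poly_Mapping.keys p \<subseteq> K"
  shows "free_extend \<sigma> f p = (\<Sum>k\<in>K. \<sigma> (Poly_Mapping.lookup p k) *\<^sub>C f k)"
  unfolding free_extend_def using assms
  by (intro sum.mono_neutral_left) (auto simp: in_keys_iff)

lemma free_extend_single: "\<sigma> 0 = 0 \<Longrightarrow> free_extend \<sigma> f (Poly_Mapping.single k c) = \<sigma> c *\<^sub>C f k"
  by (subst free_extend_superset[where K = "{k}"]) auto

lemma free_extend_add:
  assumes "\<sigma> 0 = 0" "\<And>c d. \<sigma> (c + d) = \<sigma> c + \<sigma> d"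
  shows "free_extend \<sigma> f (p + q) = free_extend \<sigma> f p + free_extend \<sigma> f q"
proof -
  let ?K = "Poly_Mapping.keys p \<union> Poly_Mapping.keys q"
  show ?thesis
    using keys_add[of p q]
    by (simp add: free_extend_superset[where \<sigma> = \<sigma>, OF assms(1), where K = ?K] lookup_add assms(2)
        scaleC_add_left sum.distrib)
qed

lemma free_extend_scale:
  assumes "\<sigma> 0 = 0" "\<And>c d. \<sigma> (c * d) = \<sigma> c * \<sigma> d"
  shows "free_extend \<sigma> f (free_scale c p) = \<sigma> c *\<^sub>C free_extend \<sigma> f p"
proof -
  have "Poly_Mapping.keys (free_scale c p) \<subseteq> Poly_Mapping.keys p"
    by (auto simp: in_keys_iff)
  then show ?thesis
    by (simp add: free_extend_superset[where \<sigma> = \<sigma>, OF assms(1), where K = "Poly_Mapping.keys p"] assms(2)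
        complex_vector.scale_sum_right)
qed

lemma free_extend_cong_rel:
  assumes \<sigma>: "\<sigma> 0 = 0" "\<sigma> 1 = 1" "\<And>c d. \<sigma> (c + d) = \<sigma> c + \<sigma> d" "\<And>c d. \<sigma> (c * d) = \<sigma> c * \<sigma> d"
    and f: "\<And>x x' y. f (x + x', y) = f (x, y) + f (x', y)" "\<And>x y y'. f (x, y + y') = f (x, y) + f (x, y')"
      "\<And>c x y. f (c *\<^sub>C x, y) = \<sigma> c *\<^sub>C f (x, y)" "\<And>c x y. f (x, c *\<^sub>C y) = \<sigma> c *\<^sub>C f (x, y)"
    and "tensor_rel p q"
  shows "free_extend \<sigma> f p = free_extend \<sigma> f q"
proof -
  have diff: "free_extend \<sigma> f (p - q) = free_extend \<sigma> f p - free_extend \<sigma> f q" for p q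
    using free_extend_add[where \<sigma> = \<sigma>, OF \<sigma>(1,3), where f = f and p = "p - q" and q = q] by simp
  have "free_extend \<sigma> f r = 0" if "r \<in> free.span tensor_relators" for r
    using that
  proof (induct rule: free.span_induct_alt)
    case base
    show ?case by (simp add: free_extend_def)
  next
    case (step c x y)
    have "free_extend \<sigma> f x = 0"
      using step(1) by (auto simp: tensor_relators_def diff free_extend_single[where \<sigma> = \<sigma>, OF \<sigma>(1)] \<sigma>(2) f)
    then show ?case
      using step by (simp add: free_extend_add[where \<sigma> = \<sigma>, OF \<sigma>(1,3)] free_extend_scale[where \<sigma> = \<sigma>, OF \<sigma>(1,4)])
  qed
  from this[of "p - q"] show ?thesis
    using assms(9) by (simp add: diff tensor_rel_def)
qed

text \<open>
  For bilinear \<open>f\<close>, the linear map induced by the universal property. With a coproduct \<open>\<Delta>\<close>,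
  \<open>tensor_lift f (\<Delta> a)\<close> is the Sweedler expression \<open>f a\<^sub>(\<^sub>1\<^sub>) a\<^sub>(\<^sub>2\<^sub>)\<close>.
\<close>

definition tensor_lift ::
  "('a::complex_vector \<Rightarrow> 'b::complex_vector \<Rightarrow> 'c::complex_vector) \<Rightarrow> ('a, 'b) tensor \<Rightarrow> 'c"
  where "tensor_lift f t = free_extend (\<lambda>c. c) (\<lambda>(x, y). f x y) (rep_tensor t)"

lemma rep_abs_tensor_rel: "tensor_rel (rep_tensor (abs_tensor p)) p"
  by (rule rep_abs_rsp_left[OF Quotient3_tensor]) (simp add: tensor_rel_def free.span_zero)

lemma tensor_lift_abs:
  assumes "cbilinear f"
  shows "tensor_lift f (abs_tensor p) = free_extend (\<lambda>c. c) (\<lambda>(x, y). f x y) p"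
  unfolding tensor_lift_def using assms
  by (intro free_extend_cong_rel rep_abs_tensor_rel) (simp_all add: cbilinear_def clinear_iff)

lemma clinear_tensor_lift:
  assumes "cbilinear f"
  shows "clinear (tensor_lift f)"
proof (rule clinearI)
  fix s t :: "('a, 'b) tensor" and c :: complex
  obtain p q where "s = abs_tensor p" "t = abs_tensor q"
    by (metis Quotient_abs_rep[OF Quotient_tensor])
  then show "tensor_lift f (s + t) = tensor_lift f s + tensor_lift f t"
    "tensor_lift f (c *\<^sub>C t) = c *\<^sub>C tensor_lift f t"
    using assms by (simp_all add: plus_tensor.abs_eq scaleC_tensor.abs_eq tensor_lift_abs
        free_extend_add free_extend_scale)
qed

lemma tensor_lift_pure [simp]:
  assumes "cbilinear f"
  shows "tensor_lift f (x \<otimes> y) = f x y"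
  using assms by (simp add: tensor_op.abs_eq tensor_lift_abs free_extend_single)

lemma tensor_lift_unique:
  assumes "clinear g" "clinear h" "\<And>x y. g (x \<otimes> y) = h (x \<otimes> y)"
  shows "g = h"
proof
  fix t show "g t = h t"
    using assms by (induct t rule: tensor_induct) (simp_all add: clinear_zero clinear_add)
qed

definition tensor_map :: "('a::complex_vector \<Rightarrow> 'c::complex_vector) \<Rightarrow> ('b::complex_vector \<Rightarrow> 'd::complex_vector)
    \<Rightarrow> ('a, 'b) tensor \<Rightarrow> ('c, 'd) tensor"
  where "tensor_map f g = tensor_lift (\<lambda>x y. f x \<otimes> g y)"

definition tensor_assoc :: "(('a::complex_vector, 'b::complex_vector) tensor, 'c::complex_vector) tensor
    \<Rightarrow> ('a, ('b, 'c) tensor) tensor"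
  where "tensor_assoc = tensor_lift (\<lambda>t z. tensor_lift (\<lambda>x y. x \<otimes> (y \<otimes> z)) t)"


lemma tensor_map_pure:
  assumes "clinear f" "clinear g"
  shows "tensor_map f g (x \<otimes> y) = f x \<otimes> g y"
  unfolding tensor_map_def using assms
  by (subst tensor_lift_pure)
    (simp_all add: cbilinear_def clinear_iff tensor_add_left tensor_add_right
      tensor_scaleC_left tensor_scaleC_right)

lemma tensor_lift_fun_add:
  "tensor_lift (\<lambda>x y. f x y + g x y) t = tensor_lift f t + tensor_lift g t"
  by (simp add: tensor_lift_def free_extend_def split_beta scaleC_add_right sum.distrib)

lemma tensor_lift_fun_scaleC:
  "tensor_lift (\<lambda>x y. c *\<^sub>C f x y) t = c *\<^sub>C tensor_lift f t"
  by (simp add: tensor_lift_def free_extend_def split_beta complex_vector.scale_sum_right mult.commute)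

lemma tensor_assoc_pure:
  fixes x :: "'a::complex_vector" and y :: "'b::complex_vector" and z :: "'c::complex_vector"
  shows "tensor_assoc ((x \<otimes> y) \<otimes> z) = x \<otimes> (y \<otimes> z)"
proof -
  have inner: "cbilinear (\<lambda>(x :: 'a) (y :: 'b). x \<otimes> (y \<otimes> z))" for z :: 'c
    by (simp add: cbilinear_def clinear_iff tensor_add_left tensor_add_right
        tensor_scaleC_left tensor_scaleC_right)
  have "cbilinear (\<lambda>t (z :: 'c). tensor_lift (\<lambda>(x :: 'a) (y :: 'b). x \<otimes> (y \<otimes> z)) t)"
    unfolding cbilinear_def
  proof (intro conjI allI)
    show "clinear (\<lambda>z :: 'c. tensor_lift (\<lambda>(x :: 'a) (y :: 'b). x \<otimes> (y \<otimes> z)) t)" for t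
      by (rule clinearI) (simp_all add: tensor_add_right tensor_scaleC_right
          tensor_lift_fun_add tensor_lift_fun_scaleC)
    show "clinear (tensor_lift (\<lambda>(x :: 'a) (y :: 'b). x \<otimes> (y \<otimes> z)))" for z :: 'c
      by (rule clinear_tensor_lift[OF inner])
  qed
  then show ?thesis
    unfolding tensor_assoc_def by (simp add: inner)
qed


section \<open>Unital algebras and *-algebras\<close>

class complex_algebra_1 = complex_vector + ring_1 +
  assumes mult_scaleC_left [simp]: "(c *\<^sub>C x) * y = c *\<^sub>C (x * y)"
    and mult_scaleC_right [simp]: "x * (c *\<^sub>C y) = c *\<^sub>C (x * y)"

class complex_star_algebra = complex_algebra_1 +
  fixes star :: "'a \<Rightarrow> 'a"
  assumes star_star [simp]: "star (star x) = x"
    and star_add: "star (x + y) = star x + star y"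
    and star_scaleC: "star (c *\<^sub>C x) = cnj c *\<^sub>C star x"
    and star_mult: "star (x * y) = star y * star x"

definition algebra_hom :: "('a::complex_algebra_1 \<Rightarrow> 'b::complex_algebra_1) \<Rightarrow> bool"
  where "algebra_hom f \<longleftrightarrow> clinear f \<and> f 1 = 1 \<and> (\<forall>x y. f (x * y) = f x * f y)"

definition star_algebra_hom :: "('a::complex_star_algebra \<Rightarrow> 'b::complex_star_algebra) \<Rightarrow> bool"
  where "star_algebra_hom f \<longleftrightarrow> algebra_hom f \<and> (\<forall>x. f (star x) = star (f x))"

instantiation complex :: complex_star_algebra
begin
definition star_complex :: "complex \<Rightarrow> complex"
  where [simp]: "star_complex = cnj"
instance by standard simp_all
end

lemma ex_functional_one: "\<exists>f :: 'a::complex_algebra_1 \<Rightarrow> complex. clinear f \<and> f 1 = 1"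
proof -
  interpret vector_space_pair "scaleC :: complex \<Rightarrow> 'a \<Rightarrow> 'a" "scaleC :: complex \<Rightarrow> complex \<Rightarrow> complex" ..
  have "complex_vector.independent {1 :: 'a}" by simp
  from linear_independent_extend[OF this, of "\<lambda>_. 1"] show ?thesis by auto
qed

lemma one_tensor_one_nonzero: "(1 :: 'a::complex_algebra_1) \<otimes> (1 :: 'b::complex_algebra_1) \<noteq> 0"
proof -
  obtain f :: "'a \<Rightarrow> complex" where f: "clinear f" "f 1 = 1" using ex_functional_one by blast
  obtain g :: "'b \<Rightarrow> complex" where g: "clinear g" "g 1 = 1" using ex_functional_one by blast
  have bil: "cbilinear (\<lambda>x y. f x * g y)"
    using f g by (simp add: cbilinear_def clinear_iff algebra_simps)
  have "tensor_lift (\<lambda>x y. f x * g y) (1 \<otimes> 1) = 1"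
    using bil f g by simp
  then show ?thesis
    using clinear_zero[OF clinear_tensor_lift[OF bil]] by fastforce
qed

lemma cbilinear_tensor_mult_inner:
  fixes x :: "'a::complex_algebra_1" and y :: "'b::complex_algebra_1"
  shows "cbilinear (\<lambda>z w. (x * z) \<otimes> (y * w))"
  by (simp add: cbilinear_def clinear_iff distrib_left tensor_add_left tensor_add_right
      tensor_scaleC_left tensor_scaleC_right)

lemma cbilinear_tensor_mult:
  fixes u :: "('a::complex_algebra_1, 'b::complex_algebra_1) tensor"
  shows "cbilinear (\<lambda>x y. tensor_lift (\<lambda>z w. (x * z) \<otimes> (y * w)) u)"
proof (induct u rule: tensor_induct)
  case zero
  then show ?case
    by (simp add: clinear_zero[OF clinear_tensor_lift[OF cbilinear_tensor_mult_inner]]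
        cbilinear_def clinear_iff del: mult_scaleC_left)
next
  case (add s t)
  then show ?case
    by (simp add: clinear_add[OF clinear_tensor_lift[OF cbilinear_tensor_mult_inner]]
        cbilinear_def clinear_iff complex_vector.scale_right_distrib algebra_simps)
next
  case (pure z w)
  then show ?case
    by (simp add: cbilinear_tensor_mult_inner)
       (simp add: cbilinear_def clinear_iff distrib_right tensor_add_left tensor_add_right
      tensor_scaleC_left tensor_scaleC_right)
qed

instantiation tensor :: (complex_algebra_1, complex_algebra_1) complex_algebra_1
begin

definition one_tensor :: "('a, 'b) tensor"
  where "one_tensor = 1 \<otimes> 1"

definition times_tensor :: "('a, 'b) tensor \<Rightarrow> ('a, 'b) tensor \<Rightarrow> ('a, 'b) tensor"
  where "times_tensor t u = tensor_lift (\<lambda>x y. tensor_lift (\<lambda>z w. (x * z) \<otimes> (y * w)) u) t"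

lemma tensor_mult_pure [simp]: "(x \<otimes> y) * (z \<otimes> w) = (x * z) \<otimes> (y * w)"
  for x :: 'a and y :: 'b
  unfolding times_tensor_def
  by (subst tensor_lift_pure[OF cbilinear_tensor_mult]) (rule tensor_lift_pure[OF cbilinear_tensor_mult_inner])

lemma clinear_mult_left: "clinear (\<lambda>t :: ('a, 'b) tensor. t * u)"
  unfolding times_tensor_def by (rule clinear_tensor_lift[OF cbilinear_tensor_mult])

lemma clinear_mult_right: "clinear (\<lambda>u :: ('a, 'b) tensor. t * u)"
proof (induct t rule: tensor_induct)
  case zero
  then show ?case
    by (simp add: clinear_zero[OF clinear_mult_left] clinear_iff)
next
  case (add s t)
  then show ?case
    by (simp add: clinear_add[OF clinear_mult_left] clinear_iff complex_vector.scale_right_distrib algebra_simps)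
next
  case (pure x y)
  have "(\<lambda>u. (x \<otimes> y) * u) = tensor_lift (\<lambda>z w. (x * z) \<otimes> (y * w))"
    by (simp add: times_tensor_def cbilinear_tensor_mult)
  then show ?case
    by (simp add: clinear_tensor_lift cbilinear_tensor_mult_inner)
qed

instance
proof
  fix s t u :: "('a, 'b) tensor" and c :: complex
  note lin = clinear_zero[OF clinear_mult_left] clinear_zero[OF clinear_mult_right]
    clinear_add[OF clinear_mult_left] clinear_add[OF clinear_mult_right]
  have 1: "((x * z) \<otimes> (y * w)) * u = (x \<otimes> y) * ((z \<otimes> w) * u)" for x z :: 'a and y w :: 'b
    by (induct u rule: tensor_induct) (simp_all add: lin mult.assoc del: mult_scaleC_left)
  have 2: "(x \<otimes> y) * t * u = (x \<otimes> y) * (t * u)" for x :: 'a and y :: 'b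
    by (induct t rule: tensor_induct) (simp_all add: lin 1)
  show "s * t * u = s * (t * u)"
    by (induct s rule: tensor_induct) (simp_all add: lin 2)
  show "1 * s = s" "s * 1 = s"
    unfolding one_tensor_def by (induct s rule: tensor_induct; simp add: lin)+
  show "(s + t) * u = s * u + t * u" "s * (t + u) = s * t + s * u"
    by (simp_all add: lin)
  show "(c *\<^sub>C s) * t = c *\<^sub>C (s * t)" "s * (c *\<^sub>C t) = c *\<^sub>C (s * t)"
    by (simp_all add: clinear_scaleC[OF clinear_mult_left] clinear_scaleC[OF clinear_mult_right])
  show "(0 :: ('a, 'b) tensor) \<noteq> 1"
    unfolding one_tensor_def using one_tensor_one_nonzero by metis
qed

end

instantiation tensor :: (complex_star_algebra, complex_star_algebra) complex_star_algebra
begin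

definition star_tensor :: "('a, 'b) tensor \<Rightarrow> ('a, 'b) tensor"
  where "star_tensor t = free_extend cnj (\<lambda>(x, y). star x \<otimes> star y) (rep_tensor t)"

lemma star_tensor_abs:
  "star (abs_tensor p :: ('a, 'b) tensor) = free_extend cnj (\<lambda>(x, y). star x \<otimes> star y) p"
  unfolding star_tensor_def
  by (intro free_extend_cong_rel rep_abs_tensor_rel)
    (simp_all add: star_add star_scaleC tensor_add_left tensor_add_right
      tensor_scaleC_left tensor_scaleC_right)

lemma star_tensor_pure [simp]: "star (x \<otimes> y) = star x \<otimes> star y" for x :: 'a and y :: 'b
  by (simp add: tensor_op.abs_eq[of x y] star_tensor_abs free_extend_single)

lemma star_tensor_add: "star (s + t) = star s + star t" for s t :: "('a, 'b) tensor"
proof -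
  obtain p q where "s = abs_tensor p" "t = abs_tensor q"
    by (metis Quotient_abs_rep[OF Quotient_tensor])
  then show ?thesis
    by (simp add: plus_tensor.abs_eq star_tensor_abs free_extend_add)
qed

lemma star_tensor_scaleC: "star (c *\<^sub>C t) = cnj c *\<^sub>C star t" for t :: "('a, 'b) tensor"
proof -
  obtain p where "t = abs_tensor p"
    by (metis Quotient_abs_rep[OF Quotient_tensor])
  then show ?thesis
    by (simp add: scaleC_tensor.abs_eq star_tensor_abs free_extend_scale)
qed

instance
proof
  fix s t u :: "('a, 'b) tensor" and c :: complex
  have zero: "star (0 :: ('a, 'b) tensor) = 0"
    using star_tensor_scaleC[of 0] by simp
  show "star (s + t) = star s + star t" "star (c *\<^sub>C t) = cnj c *\<^sub>C star t"
    by (rule star_tensor_add star_tensor_scaleC)+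
  show "star (star t) = t"
    by (induct t rule: tensor_induct) (simp_all add: zero star_tensor_add)
  have 1: "star ((x \<otimes> y) * t) = star t * star (x \<otimes> y)" for x :: 'a and y :: 'b
    by (induct t rule: tensor_induct)
      (simp_all add: zero star_tensor_add star_mult distrib_left distrib_right)
  show "star (s * t) = star t * star s"
    by (induct s rule: tensor_induct)
      (simp_all only: 1 zero star_tensor_add distrib_left distrib_right mult_zero_left mult_zero_right)
qed

end


section \<open>Hopf *-algebras and admissible bijections\<close>

locale hopf_star_algebra =
  fixes \<Delta> :: "'a::complex_star_algebra \<Rightarrow> ('a, 'a) tensor"
    and \<epsilon> :: "'a \<Rightarrow> complex"
    and S :: "'a \<Rightarrow> 'a"
  assumes comult_hom: "star_algebra_hom \<Delta>"
    and counit_hom: "star_algebra_hom \<epsilon>"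
    and coassoc: "tensor_assoc (tensor_map \<Delta> id (\<Delta> a)) = tensor_map id \<Delta> (\<Delta> a)"
    and counit_left: "tensor_lift (\<lambda>x y. \<epsilon> x *\<^sub>C y) (\<Delta> a) = a"
    and counit_right: "tensor_lift (\<lambda>x y. \<epsilon> y *\<^sub>C x) (\<Delta> a) = a"
    and antipode_linear: "clinear S"
    and antipode_left: "tensor_lift (\<lambda>x y. S x * y) (\<Delta> a) = \<epsilon> a *\<^sub>C 1"
    and antipode_right: "tensor_lift (\<lambda>x y. x * S y) (\<Delta> a) = \<epsilon> a *\<^sub>C 1"

definition admissible_bijection ::
  "('a::complex_star_algebra \<Rightarrow> ('a, 'a) tensor) \<Rightarrow> ('a \<Rightarrow> 'a) \<Rightarrow> bool"
  where "admissible_bijection \<Delta> \<alpha> \<longleftrightarrow>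
    algebra_hom \<alpha> \<and>
    \<alpha> \<circ> star \<circ> \<alpha> \<circ> star = id \<and>
    tensor_map \<alpha> \<alpha> \<circ> \<Delta> = \<Delta> \<circ> \<alpha> \<and>
    bij (\<lambda>a. a + \<alpha> a) \<and>
    bij (\<lambda>t. tensor_map id id t + tensor_map \<alpha> \<alpha> t)"


section \<open>Pre-Hilbert spaces and representations\<close>

text \<open>
  The inner product is linear in its second argument. The real normed structure, which is
  the one induced by the inner product, provides the topology.
\<close>

class pre_hilbert = complex_vector + real_normed_vector +
  fixes cinner :: "'a \<Rightarrow> 'a \<Rightarrow> complex"
  assumes scaleR_scaleC: "r *\<^sub>R x = complex_of_real r *\<^sub>C x"
    and cinner_commute: "cinner x y = cnj (cinner y x)"
    and cinner_add_right: "cinner x (y + z) = cinner x y + cinner x z"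
    and cinner_scaleC_right: "cinner x (c *\<^sub>C y) = c * cinner x y"
    and cinner_nonneg: "cinner x x \<in> \<real>\<^sub>\<ge>\<^sub>0"
    and cinner_eq_zero_iff: "cinner x x = 0 \<longleftrightarrow> x = 0"
    and norm_eq_sqrt_cinner: "norm x = sqrt (Re (cinner x x))"

definition is_adjoint :: "('d::pre_hilbert \<Rightarrow> 'd) \<Rightarrow> ('d \<Rightarrow> 'd) \<Rightarrow> bool"
  where "is_adjoint T T' \<longleftrightarrow> (\<forall>x y. cinner (T' x) y = cinner x (T y))"

text \<open>\<open>adjointable_ops\<close> is the *-algebra usually denoted \<open>\<L>\<close>-dagger of \<open>D\<close>.\<close>

definition adjointable_ops :: "('d::pre_hilbert \<Rightarrow> 'd) set"
  where "adjointable_ops = {T. clinear T \<and> (\<exists>T'. clinear T' \<and> is_adjoint T T')}"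

definition adjoint_op :: "('d::pre_hilbert \<Rightarrow> 'd) \<Rightarrow> ('d \<Rightarrow> 'd)"
  where "adjoint_op T = (THE T'. is_adjoint T T')"

lemma adjoint_op_eq:
  assumes "is_adjoint T T'"
  shows "adjoint_op T = T'"
  unfolding adjoint_op_def
proof (rule the_equality[where P = "is_adjoint T", OF assms], rule ext)
  fix R x assume "is_adjoint T R"
  then have eq: "cinner (R x) y = cinner (T' x) y" for y
    using assms by (simp add: is_adjoint_def)
  have "cinner y (R x - T' x) = 0" for y
    using cinner_add_right[of y "R x - T' x" "T' x"] eq[of y]
    by (simp add: cinner_commute[of y])
  then show "R x = T' x"
    by (metis cinner_eq_zero_iff eq_iff_diff_eq_0)
qed

definition representation :: "('a::complex_star_algebra \<Rightarrow> 'd::pre_hilbert \<Rightarrow> 'd) \<Rightarrow> bool"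
  where "representation \<pi> \<longleftrightarrow>
    (\<forall>a. \<pi> a \<in> adjointable_ops) \<and>
    (\<forall>a b. \<pi> (a + b) = (\<lambda>x. \<pi> a x + \<pi> b x)) \<and>
    (\<forall>c a. \<pi> (c *\<^sub>C a) = (\<lambda>x. c *\<^sub>C \<pi> a x)) \<and>
    \<pi> 1 = id \<and>
    (\<forall>a b. \<pi> (a * b) = \<pi> a \<circ> \<pi> b) \<and>
    (\<forall>a. \<pi> (star a) = adjoint_op (\<pi> a))"


section \<open>Cocycles and generating functionals\<close>

text \<open>In the following, \<open>S\<alpha>\<close> stands for the composition of the antipode with \<open>\<alpha>\<close>.\<close>

definition cocycle :: "('a::complex_star_algebra \<Rightarrow> complex) \<Rightarrow> ('a \<Rightarrow> 'd::pre_hilbert) \<Rightarrow> bool"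
  where "cocycle \<epsilon> \<eta> \<longleftrightarrow>
    clinear \<eta> \<and>
    (\<exists>\<pi>. representation \<pi> \<and> (\<forall>a b. \<eta> (a * b) = \<pi> a (\<eta> b) + \<epsilon> b *\<^sub>C \<eta> a)) \<and>
    closure (range \<eta>) = UNIV"

definition real_cocycle ::
  "('a::complex_star_algebra \<Rightarrow> complex) \<Rightarrow> ('a \<Rightarrow> 'a) \<Rightarrow> ('a \<Rightarrow> 'd::pre_hilbert) \<Rightarrow> bool"
  where "real_cocycle \<epsilon> S\<alpha> \<eta> \<longleftrightarrow> cocycle \<epsilon> \<eta> \<and>
    (\<forall>a b. cinner (\<eta> a) (\<eta> b) = cinner (\<eta> (star (S\<alpha> b))) (\<eta> (S\<alpha> (star a))))"

definition generating_functional ::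
  "('a::complex_star_algebra \<Rightarrow> complex) \<Rightarrow> ('a \<Rightarrow> complex) \<Rightarrow> bool"
  where "generating_functional \<epsilon> L \<longleftrightarrow>
    clinear L \<and>
    (\<forall>a. \<epsilon> a = 0 \<longrightarrow> L (star a * a) \<in> \<real>\<^sub>\<ge>\<^sub>0) \<and>
    (\<forall>b. L (star b) = cnj (L b)) \<and>
    L 1 = 0"

definition yields_coboundary ::
  "('a::complex_star_algebra \<Rightarrow> complex) \<Rightarrow> ('a \<Rightarrow> 'd::pre_hilbert) \<Rightarrow> ('a \<Rightarrow> complex) \<Rightarrow> bool"
  where "yields_coboundary \<epsilon> \<eta> L \<longleftrightarrow>
    (\<forall>a b. L (a * b) = \<epsilon> a * L b + L a * \<epsilon> b + cinner (\<eta> (star a)) (\<eta> b))"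

end

theory Submission
  imports Defs
begin

text \<open>
  The function \<open>\<phi> x y = \<langle>\<eta> (x\<^sup>*), \<eta> y\<rangle>\<close> is a normalised 2-cocycle, and \<open>\<alpha>\<close>-reality of \<open>\<eta>\<close> reads
  \<open>\<phi> x y = \<phi> (S\<^sub>\<alpha> y) (S\<^sub>\<alpha> x)\<close>. The cocycle identity computes the coboundary of
  \<open>f x = \<phi> (S x\<^sub>(\<^sub>1\<^sub>)) x\<^sub>(\<^sub>2\<^sub>)\<close>. With \<open>L \<circ> \<gamma> = - f \<circ> \<alpha>\<close> and reality, this says that
  the coboundary of \<open>L\<close> and \<open>\<phi>\<close> agree on the range of \<open>id \<otimes> id + \<alpha> \<otimes> \<alpha>\<close>, hence everywhere.
  Positivity of \<open>L\<close> on the kernel of \<open>\<epsilon>\<close> is then immediate, and applying \<open>L\<close> to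
  \<open>S x\<^sub>(\<^sub>1\<^sub>) x\<^sub>(\<^sub>2\<^sub>) = \<epsilon> x\<close> gives \<open>L x + L (S x) = - f x\<close>, from which \<open>S\<^sub>\<alpha>\<close>-invariance follows
  by comparison with \<open>L x + L (\<alpha> x) = - f (\<alpha> x)\<close>.
  That \<open>L\<close> is hermitian comes from the second expression \<open>f x = \<phi> x\<^sub>(\<^sub>1\<^sub>) (S x\<^sub>(\<^sub>2\<^sub>))\<close>.
\<close>

section \<open>Linear maps and the tensor product\<close>

lemma clinear_sum: "clinear g \<Longrightarrow> g (sum f A) = (\<Sum>i\<in>A. g (f i))"
  by (induct A rule: infinite_finite_induct) (simp_all add: clinear_zero clinear_add)

text \<open>
  No bilinearity of \<open>F\<close> is needed in the next two lemmas, since \<open>tensor_lift F t\<close> is by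
  definition a finite sum over a fixed representative of \<open>t\<close>.
\<close>

lemma clinear_tensor_lift_apply:
  "clinear g \<Longrightarrow> g (tensor_lift F t) = tensor_lift (\<lambda>x y. g (F x y)) t"
  by (simp add: tensor_lift_def free_extend_def clinear_sum clinear_scaleC split_beta)

lemma tensor_lift_swap:
  "tensor_lift (\<lambda>x y. tensor_lift (\<lambda>z w. F x y z w) u) t =
    tensor_lift (\<lambda>z w. tensor_lift (\<lambda>x y. F x y z w) t) u"
  unfolding tensor_lift_def free_extend_def split_beta complex_vector.scale_sum_right
  by (subst sum.swap) (simp add: mult.commute)

lemma tensor_lift_fun_times:
  "tensor_lift (\<lambda>x y. c * f x y) t = c * tensor_lift f t" for c :: "'a::complex_algebra_1"
  by (rule clinear_tensor_lift_apply[symmetric]) (simp add: clinear_iff distrib_left)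

lemma tensor_lift_fun_times_right:
  "tensor_lift (\<lambda>x y. f x y * c) t = tensor_lift f t * c" for c :: "'a::complex_algebra_1"
  by (rule clinear_tensor_lift_apply[symmetric]) (simp add: clinear_iff distrib_right)

lemma tensor_lift_fun_diff:
  "tensor_lift (\<lambda>x y. f x y - g x y) t = tensor_lift f t - tensor_lift g t"
  by (simp add: tensor_lift_def free_extend_def split_beta complex_vector.scale_right_diff_distrib
      sum_subtractf)

lemmas tensor_lift_fun =
  tensor_lift_fun_add tensor_lift_fun_scaleC tensor_lift_fun_times tensor_lift_fun_times_right
  tensor_lift_fun_diff

lemma clinear_tensor_map:
  assumes "clinear f" "clinear g"
  shows "clinear (tensor_map f g)"
  unfolding tensor_map_def using assms
  by (intro clinear_tensor_lift) (simp add: cbilinear_def clinear_iff tensor_add_left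
      tensor_add_right tensor_scaleC_left tensor_scaleC_right)

lemma clinear_compose: "clinear f \<Longrightarrow> clinear g \<Longrightarrow> clinear (\<lambda>x. f (g x))"
  by (simp add: clinear_iff)

lemma tensor_map_id: "tensor_map id id t = t" for t :: "('a::complex_vector, 'b::complex_vector) tensor"
proof -
  have lin: "clinear (id :: 'c::complex_vector \<Rightarrow> 'c)"
    by (simp add: clinear_iff)
  have "tensor_map id id = (id :: ('a, 'b) tensor \<Rightarrow> _)"
    by (rule tensor_lift_unique[OF clinear_tensor_map[OF lin lin] lin])
      (simp only: tensor_map_pure[OF lin lin] id_apply)
  then show ?thesis by (simp only: id_apply)
qed

lemma tensor_lift_tensor_map:
  assumes "clinear f" "clinear g" "cbilinear F"
  shows "tensor_lift F (tensor_map f g t) = tensor_lift (\<lambda>x y. F (f x) (g y)) t"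
proof -
  have "cbilinear (\<lambda>x y. F (f x) (g y))"
    using assms by (simp add: cbilinear_def clinear_iff)
  then have "(\<lambda>t. tensor_lift F (tensor_map f g t)) = tensor_lift (\<lambda>x y. F (f x) (g y))"
    using assms
    by (intro tensor_lift_unique clinear_tensor_lift
        clinear_compose[OF clinear_tensor_lift[OF assms(3)] clinear_tensor_map[OF assms(1,2)]])
      (simp_all add: tensor_map_pure)
  then show ?thesis by metis
qed

text \<open>The conjugate-linear maps \<open>h\<close> and \<open>star\<close> compose to a linear
  map, so agreement on pure tensors suffices.\<close>

lemma tensor_lift_star:
  assumes F: "cbilinear F"
    and h: "\<And>x y. h (x + y) = h x + h y" "\<And>c x. h (c *\<^sub>C x) = cnj c *\<^sub>C h x"
  shows "h (tensor_lift F (star t)) = tensor_lift (\<lambda>x y. h (F (star x) (star y))) t"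
proof -
  have bil: "cbilinear (\<lambda>x y. h (F (star x) (star y)))"
    using F h by (simp add: cbilinear_def clinear_iff star_add star_scaleC)
  have "clinear (\<lambda>t. h (tensor_lift F (star t)))"
    using clinear_tensor_lift[OF F] h by (simp add: clinear_iff star_add star_scaleC)
  then have "(\<lambda>t. h (tensor_lift F (star t))) = tensor_lift (\<lambda>x y. h (F (star x) (star y)))"
    by (rule tensor_lift_unique) (use F bil clinear_tensor_lift in simp_all)
  then show ?thesis by metis
qed

text \<open>Uniqueness on pure tensors is used twice: in \<open>t\<close> with the left factor pure,
  then in \<open>s\<close>.\<close>

lemma tensor_lift_mult:
  fixes s t :: "('a::complex_algebra_1, 'b::complex_algebra_1) tensor"
  assumes F: "cbilinear F"
  shows "tensor_lift F (s * t) =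
    tensor_lift (\<lambda>x y. tensor_lift (\<lambda>z w. F (x * z) (y * w)) t) s"
proof -
  have inner: "cbilinear (\<lambda>z w. F (x * z) (y * w))" for x :: 'a and y :: 'b
    using F by (simp add: cbilinear_def clinear_iff distrib_left)
  have outer: "cbilinear (\<lambda>x y. tensor_lift (\<lambda>z w. F (x * z) (y * w)) t)"
    for t :: "('a, 'b) tensor"
    using F by (simp add: cbilinear_def clinear_iff distrib_right tensor_lift_fun)
  have "(\<lambda>t. tensor_lift F ((x \<otimes> y) * t)) = tensor_lift (\<lambda>z w. F (x * z) (y * w))" for x y
    using clinear_tensor_lift[OF F] clinear_tensor_lift[OF inner]
    by (intro tensor_lift_unique) (simp_all add: clinear_iff distrib_left F inner)
  then have pure: "tensor_lift F ((x \<otimes> y) * t) = tensor_lift (\<lambda>z w. F (x * z) (y * w)) t" for x y t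
    by metis
  have "(\<lambda>s. tensor_lift F (s * t)) = tensor_lift (\<lambda>x y. tensor_lift (\<lambda>z w. F (x * z) (y * w)) t)"
    using clinear_tensor_lift[OF F] clinear_tensor_lift[OF outer]
    by (intro tensor_lift_unique) (simp_all add: clinear_iff distrib_right pure outer)
  then show ?thesis by metis
qed

lemma clinear_tensor_assoc:
  "clinear (tensor_assoc :: (('a::complex_vector, 'b::complex_vector) tensor, 'c::complex_vector) tensor \<Rightarrow> _)"
proof -
  note tensor_simps = tensor_add_left tensor_add_right tensor_scaleC_left tensor_scaleC_right
  have "cbilinear (\<lambda>(x :: 'a) (y :: 'b). x \<otimes> (y \<otimes> z))" for z :: 'c
    by (simp add: cbilinear_def clinear_iff tensor_simps)
  from clinear_tensor_lift[OF this] show ?thesis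
    unfolding tensor_assoc_def
    by (intro clinear_tensor_lift) (simp add: cbilinear_def clinear_iff tensor_lift_fun tensor_simps)
qed

text \<open>The curried shape matches lifts nested along right-bracketed triple tensors.\<close>

definition ctrilinear ::
  "('a::complex_vector \<Rightarrow> 'b::complex_vector \<Rightarrow> 'c::complex_vector \<Rightarrow> 'd::complex_vector) \<Rightarrow> bool"
  where "ctrilinear F \<longleftrightarrow> (\<forall>x. cbilinear (F x)) \<and> (\<forall>y z. clinear (\<lambda>x. F x y z))"

lemma cbilinear_tensor_lift:
  assumes F: "ctrilinear F"
  shows "cbilinear (\<lambda>x. tensor_lift (F x))"
proof -
  have bil: "cbilinear (F x)" for x
    using F by (simp add: ctrilinear_def)
  have "F (x + x') = (\<lambda>y z. F x y z + F x' y z)" "F (c *\<^sub>C x) = (\<lambda>y z. c *\<^sub>C F x y z)" for x x' c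
    using F by (simp_all add: ctrilinear_def clinear_iff fun_eq_iff)
  then show ?thesis
    using clinear_tensor_lift[OF bil] by (simp add: cbilinear_def clinear_iff tensor_lift_fun)
qed

text \<open>A pure outer factor \<open>z\<close> is the case met in coassociativity, where
  \<open>tensor_map \<Delta> id\<close> sends \<open>x \<otimes> z\<close> to
  \<open>\<Delta> x \<otimes> z\<close>.\<close>

lemma tensor_lift_tensor_assoc:
  assumes F: "ctrilinear F"
  shows "tensor_lift (\<lambda>x. tensor_lift (F x)) (tensor_assoc (s \<otimes> z)) =
    tensor_lift (\<lambda>x y. F x y z) s"
proof -
  have bil: "cbilinear (F x)" "cbilinear (\<lambda>x y. F x y z)" for x z
    using F by (simp_all add: ctrilinear_def cbilinear_def)
  note nested = cbilinear_tensor_lift[OF F]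
  have "(\<lambda>s. tensor_lift (\<lambda>x. tensor_lift (F x)) (tensor_assoc (s \<otimes> z))) =
      tensor_lift (\<lambda>x y. F x y z)"
    by (intro tensor_lift_unique clinear_compose[OF clinear_tensor_lift[OF nested]]
        clinear_compose[OF clinear_tensor_assoc] clinear_tensor_lift[OF bil(2)])
      (simp_all add: clinear_iff tensor_add_left tensor_scaleC_left tensor_assoc_pure bil nested)
  then show ?thesis by metis
qed


section \<open>Sweedler calculus\<close>

lemma star_one: "star 1 = (1 :: 'a::complex_star_algebra)"
  using star_mult[of 1 "star (1 :: 'a)"] by simp

context hopf_star_algebra
begin

abbreviation sweedler :: "('a \<Rightarrow> 'a \<Rightarrow> 'c::complex_vector) \<Rightarrow> 'a \<Rightarrow> 'c"
  where "sweedler F a \<equiv> tensor_lift F (\<Delta> a)"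

lemma
  comult_add: "\<Delta> (a + b) = \<Delta> a + \<Delta> b" and
  comult_scaleC: "\<Delta> (c *\<^sub>C a) = c *\<^sub>C \<Delta> a" and
  comult_one: "\<Delta> 1 = 1 \<otimes> 1" and
  comult_mult: "\<Delta> (a * b) = \<Delta> a * \<Delta> b" and
  comult_star: "\<Delta> (star a) = star (\<Delta> a)"
  using comult_hom by (simp_all add: star_algebra_hom_def algebra_hom_def clinear_iff one_tensor_def)

lemma
  counit_add [simp]: "\<epsilon> (a + b) = \<epsilon> a + \<epsilon> b" and
  counit_scaleC [simp]: "\<epsilon> (c *\<^sub>C a) = c * \<epsilon> a" and
  counit_one [simp]: "\<epsilon> 1 = 1" and
  counit_mult [simp]: "\<epsilon> (a * b) = \<epsilon> a * \<epsilon> b" and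
  counit_star [simp]: "\<epsilon> (star a) = cnj (\<epsilon> a)"
  using counit_hom by (simp_all add: star_algebra_hom_def algebra_hom_def clinear_iff)

lemma
  antipode_add [simp]: "S (a + b) = S a + S b" and
  antipode_scaleC [simp]: "S (c *\<^sub>C a) = c *\<^sub>C S a"
  using antipode_linear by (simp_all add: clinear_iff)

lemma clinear_sweedler: "cbilinear F \<Longrightarrow> clinear (sweedler F)"
  by (drule clinear_tensor_lift) (simp add: clinear_iff comult_add comult_scaleC)

lemma sweedler_mult:
  "cbilinear F \<Longrightarrow> sweedler F (a * b) = sweedler (\<lambda>x y. sweedler (\<lambda>z w. F (x * z) (y * w)) b) a"
  by (simp add: comult_mult tensor_lift_mult)

text \<open>One linear map, the nested lift of \<open>F\<close>, is evaluated at the two sides of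
  the coassociativity axiom.\<close>

lemma sweedler_coassoc:
  assumes F: "ctrilinear F"
  shows "sweedler (\<lambda>x z. sweedler (\<lambda>x y. F x y z) x) a = sweedler (\<lambda>x y. sweedler (F x) y) a"
proof -
  let ?H = "tensor_lift (\<lambda>x. tensor_lift (F x))"
  have bil: "cbilinear (\<lambda>x y. F x y z)" for z
    using F by (simp add: ctrilinear_def cbilinear_def)
  note nested = cbilinear_tensor_lift[OF F]
  have lin: "clinear \<Delta>" "clinear (id :: 'a \<Rightarrow> 'a)"
    by (simp_all add: clinear_iff comult_add comult_scaleC)
  have left: "cbilinear (\<lambda>x z. sweedler (\<lambda>x y. F x y z) x)"
    using F clinear_sweedler[OF bil]
    by (simp add: ctrilinear_def cbilinear_def clinear_iff tensor_lift_fun)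
  have right: "cbilinear (\<lambda>x y. sweedler (F x) y)"
    using nested by (simp add: cbilinear_def clinear_iff comult_add comult_scaleC)
  have "(\<lambda>t. ?H (tensor_assoc (tensor_map \<Delta> id t))) =
      tensor_lift (\<lambda>x z. sweedler (\<lambda>x y. F x y z) x)"
    by (intro tensor_lift_unique clinear_compose[OF clinear_tensor_lift[OF nested]]
        clinear_compose[OF clinear_tensor_assoc] clinear_tensor_map clinear_tensor_lift[OF left] lin)
      (simp add: tensor_map_pure lin tensor_lift_tensor_assoc[OF F] left)
  then have "?H (tensor_assoc (tensor_map \<Delta> id (\<Delta> a))) = sweedler (\<lambda>x z. sweedler (\<lambda>x y. F x y z) x) a"
    by metis
  moreover have "?H (tensor_map id \<Delta> (\<Delta> a)) = sweedler (\<lambda>x y. sweedler (F x) y) a"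
    by (simp add: tensor_lift_tensor_map lin nested)
  ultimately show ?thesis by (simp add: coassoc)
qed

text \<open>Here and in the next three lemmas \<open>g\<close> is pulled through the Sweedler sum,
  which makes the counit and antipode axioms available under any linear map.\<close>

lemma sweedler_counit_left: "clinear g \<Longrightarrow> sweedler (\<lambda>x y. \<epsilon> x *\<^sub>C g y) a = g a"
  using clinear_tensor_lift_apply[of g "\<lambda>x y. \<epsilon> x *\<^sub>C y" "\<Delta> a"]
  by (simp add: counit_left clinear_scaleC)

lemma sweedler_counit_right: "clinear g \<Longrightarrow> sweedler (\<lambda>x y. \<epsilon> y *\<^sub>C g x) a = g a"
  using clinear_tensor_lift_apply[of g "\<lambda>x y. \<epsilon> y *\<^sub>C x" "\<Delta> a"]
  by (simp add: counit_right clinear_scaleC)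

lemma sweedler_antipode_left: "clinear g \<Longrightarrow> sweedler (\<lambda>x y. g (S x * y)) a = \<epsilon> a *\<^sub>C g 1"
  using clinear_tensor_lift_apply[of g "\<lambda>x y. S x * y" "\<Delta> a"]
  by (simp add: antipode_left clinear_scaleC)

lemma sweedler_antipode_right: "clinear g \<Longrightarrow> sweedler (\<lambda>x y. g (x * S y)) a = \<epsilon> a *\<^sub>C g 1"
  using clinear_tensor_lift_apply[of g "\<lambda>x y. x * S y" "\<Delta> a"]
  by (simp add: antipode_right clinear_scaleC)


section \<open>The antipode\<close>

text \<open>
  In terms of the convolution product \<open>\<star>\<close> of linear maps, the next two lemmas say
  \<open>(f \<circ> S) \<star> (f \<star> g) = g\<close> and \<open>(g \<star> S) \<star> id = g\<close>.
\<close>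

lemma convolution_antipode_left:
  assumes f: "algebra_hom f" and g: "clinear g"
  shows "sweedler (\<lambda>x y. f (S x) * sweedler (\<lambda>y z. f y * g z) y) a = g a"
proof -
  have f': "clinear f" "f 1 = 1" "f x * f y = f (x * y)" for x y
    using f by (simp_all add: algebra_hom_def)
  have tri: "ctrilinear (\<lambda>x y z. f (S x * y) * g z)"
    using f'(1) g by (simp add: ctrilinear_def cbilinear_def clinear_iff algebra_simps)
  \<comment> \<open>Multiplicativity of \<open>f\<close> joins the first two factors;
    coassociativity can then collect \<open>S x * y\<close> in one inner sum, where the antipode
    axiom collapses it.\<close>
  have "sweedler (\<lambda>x y. f (S x) * sweedler (\<lambda>y z. f y * g z) y) a =
      sweedler (\<lambda>x y. sweedler (\<lambda>y z. f (S x * y) * g z) y) a"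
    by (simp only: tensor_lift_fun_times[symmetric] mult.assoc[symmetric] f'(3))
  also have "\<dots> = sweedler (\<lambda>x z. sweedler (\<lambda>x y. f (S x * y)) x * g z) a"
    by (simp add: sweedler_coassoc[OF tri, symmetric] tensor_lift_fun)
  also have "\<dots> = g a"
    by (simp add: sweedler_antipode_left[OF f'(1)] f'(2) sweedler_counit_left[OF g])
  finally show ?thesis .
qed

lemma convolution_antipode_right:
  assumes g: "clinear g"
  shows "sweedler (\<lambda>x z. sweedler (\<lambda>x y. g x * S y) x * z) a = g a"
proof -
  have tri: "ctrilinear (\<lambda>x y z. g x * (S y * z))"
    using g by (simp add: ctrilinear_def cbilinear_def clinear_iff algebra_simps)
  have "sweedler (\<lambda>x z. sweedler (\<lambda>x y. g x * S y) x * z) a =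
      sweedler (\<lambda>x z. sweedler (\<lambda>x y. g x * (S y * z)) x) a"
    by (simp add: tensor_lift_fun flip: mult.assoc)
  also have "\<dots> = sweedler (\<lambda>x y. g x * sweedler (\<lambda>y z. S y * z) y) a"
    by (simp add: sweedler_coassoc[OF tri] tensor_lift_fun)
  also have "\<dots> = g a"
    by (simp add: antipode_left sweedler_counit_right g)
  finally show ?thesis .
qed

lemma antipode_one: "S 1 = 1"
proof -
  have "cbilinear (\<lambda>x y. S x * y)"
    by (simp add: cbilinear_def clinear_iff algebra_simps)
  then show ?thesis
    using antipode_left[of 1] by (simp add: comult_one)
qed

text \<open>The Sweedler sum of \<open>\<epsilon> (S x * y)\<close> is evaluated by the antipode
  axiom and, using multiplicativity, by the counit axiom.\<close>

lemma counit_antipode [simp]: "\<epsilon> (S a) = \<epsilon> a"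
proof -
  have "\<epsilon> a = sweedler (\<lambda>x y. \<epsilon> (S x * y)) a"
    using sweedler_antipode_left[of \<epsilon> a] by (simp add: clinear_iff)
  also have "\<dots> = \<epsilon> (S a)"
    using sweedler_counit_right[of "\<lambda>x. \<epsilon> (S x)" a] by (simp add: clinear_iff mult.commute)
  finally show ?thesis by simp
qed

text \<open>The right antipode axiom at \<open>a * b\<close> has the leading factors of
  \<open>a\<close> and \<open>b\<close>; convolving with \<open>S\<close> from the left strips off
  first the one, then the other.\<close>

lemma antipode_mult: "S (a * b) = S b * S a"
proof -
  have conv: "sweedler (\<lambda>x y. S x * sweedler (\<lambda>y z. y * g z) y) a = g a" if "clinear g"
    for g :: "'a \<Rightarrow> 'a" and a
    using convolution_antipode_left[of "\<lambda>x. x", OF _ that]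
    by (simp add: algebra_hom_def clinear_iff)
  have bil: "cbilinear (\<lambda>x y. x * S y)"
    by (simp add: cbilinear_def clinear_iff algebra_simps)
  have lin: "clinear (\<lambda>x. sweedler (\<lambda>z w. z * S (x * w)) b)" "clinear (\<lambda>w. S (a * w))" for a b
    by (simp_all add: clinear_iff tensor_lift_fun algebra_simps)
  have mult: "sweedler (\<lambda>x y. x * sweedler (\<lambda>z w. z * S (y * w)) b) a = \<epsilon> b *\<^sub>C \<epsilon> a *\<^sub>C 1" for a b
    using antipode_right[of "a * b"]
    by (simp add: sweedler_mult[OF bil] mult.assoc tensor_lift_fun mult.commute[of "\<epsilon> b"])
  have "sweedler (\<lambda>z w. z * S (a * w)) b = \<epsilon> b *\<^sub>C S a" for a b
  proof -
    have "sweedler (\<lambda>z w. z * S (a * w)) b = sweedler (\<lambda>x y. \<epsilon> b *\<^sub>C \<epsilon> y *\<^sub>C S x) a"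
      unfolding conv[OF lin(1), of b a, symmetric] mult by simp
    then show ?thesis
      by (simp only: tensor_lift_fun_scaleC sweedler_counit_right[OF antipode_linear])
  qed
  then have "S (a * b) = sweedler (\<lambda>x y. S x * \<epsilon> y *\<^sub>C S a) b"
    using conv[OF lin(2), of a b] by simp
  also have "\<dots> = sweedler (\<lambda>x y. \<epsilon> y *\<^sub>C S x) b * S a"
    by (simp flip: tensor_lift_fun_times_right)
  finally show ?thesis
    by (simp only: sweedler_counit_right[OF antipode_linear])
qed

text \<open>Starring the left antipode axiom at \<open>star a\<close> and then applying the
  antimultiplicative \<open>S\<close> shows that the map on the left is a left convolution inverse
  of \<open>S\<close>. So is the identity, and convolving with the identity from the right makes the
  two equal.\<close>

lemma antipode_star: "S (star (S (star a))) = a"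
proof -
  have bil: "cbilinear (\<lambda>x y. S x * y)"
    by (simp add: cbilinear_def clinear_iff algebra_simps)
  have "sweedler (\<lambda>x y. y * star (S (star x))) a = star (sweedler (\<lambda>x y. S x * y) (star a))" for a
    using tensor_lift_star[where h = star, OF bil star_add star_scaleC, of "\<Delta> a"]
    by (simp add: comult_star star_mult)
  then have "sweedler (\<lambda>x y. y * star (S (star x))) a = \<epsilon> a *\<^sub>C 1" for a
    by (simp add: antipode_left star_scaleC star_one)
  then have "sweedler (\<lambda>x y. S (star (S (star x))) * S y) a = \<epsilon> a *\<^sub>C 1" for a
    using clinear_tensor_lift_apply[OF antipode_linear, of "\<lambda>x y. y * star (S (star x))" "\<Delta> a"]
    by (simp add: antipode_mult antipode_one)
  moreover have "clinear (\<lambda>a. S (star (S (star a))))"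
    by (simp add: clinear_iff star_add star_scaleC)
  ultimately show ?thesis
    using convolution_antipode_right[of "\<lambda>a. S (star (S (star a)))" a] by (simp add: counit_left)
qed

section \<open>Counit and antipode under comultiplicative maps\<close>

lemma sweedler_comult_hom:
  assumes "clinear f" "tensor_map f f (\<Delta> a) = \<Delta> (f a)" "cbilinear F"
  shows "sweedler F (f a) = sweedler (\<lambda>x y. F (f x) (f y)) a"
  unfolding assms(2)[symmetric] by (rule tensor_lift_tensor_map[OF assms(1,1,3)])

text \<open>By injectivity, \<open>\<epsilon> \<circ> f\<close> is a left counit; applying
  \<epsilon> to that identity compares it with \<epsilon>.\<close>

lemma counit_comult_hom:
  assumes f: "clinear f" "inj f" "\<And>a. tensor_map f f (\<Delta> a) = \<Delta> (f a)"
  shows "\<epsilon> (f a) = \<epsilon> a"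
proof -
  have bil: "cbilinear (\<lambda>x y :: 'a. \<epsilon> x *\<^sub>C y)"
    by (simp add: cbilinear_def clinear_iff scaleC_add_left scaleC_add_right mult.commute)
  have lin: "clinear \<epsilon>" "clinear (\<lambda>x. \<epsilon> (f x))"
    using f(1) by (simp_all add: clinear_iff)
  have "f (sweedler (\<lambda>x y. \<epsilon> (f x) *\<^sub>C y) a) = f a"
    using sweedler_comult_hom[OF f(1,3) bil, of a]
    by (simp add: counit_left clinear_tensor_lift_apply[OF f(1)] clinear_scaleC[OF f(1)])
  then have "sweedler (\<lambda>x y. \<epsilon> (f x) *\<^sub>C y) a = a"
    using f(2) by (simp add: inj_eq)
  then have "\<epsilon> a = sweedler (\<lambda>x y. \<epsilon> (f x) * \<epsilon> y) a"
    using clinear_tensor_lift_apply[OF lin(1), of "\<lambda>x y. \<epsilon> (f x) *\<^sub>C y" "\<Delta> a"] by simp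
  then show ?thesis
    using sweedler_counit_right[OF lin(2), of a] by (simp add: mult.commute)
qed

text \<open>\<open>S \<circ> f\<close> is a right convolution inverse of \<open>f\<close>, and
  \<open>f \<circ> S\<close> is a left one.\<close>

lemma antipode_comult_hom:
  assumes f: "algebra_hom f" "inj f" "\<And>a. tensor_map f f (\<Delta> a) = \<Delta> (f a)"
  shows "S (f a) = f (S a)"
proof -
  have lin: "clinear f" "clinear (\<lambda>x. S (f x))" "clinear (\<lambda>x. f (S x))"
    using f(1) by (simp_all add: algebra_hom_def clinear_iff)
  have bil: "cbilinear (\<lambda>x y. x * S y)"
    by (simp add: cbilinear_def clinear_iff algebra_simps)
  have "sweedler (\<lambda>x y. f x * S (f y)) a = \<epsilon> a *\<^sub>C 1" for a
    using sweedler_comult_hom[OF lin(1) f(3) bil, of a]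
    by (simp add: antipode_right counit_comult_hom[OF lin(1) f(2,3)])
  then show ?thesis
    using convolution_antipode_left[OF f(1) lin(2), of a] sweedler_counit_right[OF lin(3), of a]
    by simp
qed


section \<open>Normalised 2-cocycles\<close>

text \<open>These are normalised Hochschild 2-cocycles with values in the trivial bimodule, on which
  both actions are through \<epsilon>.\<close>

context
  fixes \<phi> :: "'a \<Rightarrow> 'a \<Rightarrow> complex"
  assumes bilinear: "cbilinear \<phi>"
    and cocycle: "\<And>x y z. \<phi> (x * y) z - \<epsilon> x * \<phi> y z = \<phi> x (y * z) - \<phi> x y * \<epsilon> z"
    and one_left: "\<And>x. \<phi> 1 x = 0"
    and one_right: "\<And>x. \<phi> x 1 = 0"
begin

lemma cocycle_add_scale:
  "\<phi> (x + x') y = \<phi> x y + \<phi> x' y" "\<phi> x (y + y') = \<phi> x y + \<phi> x y'"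
  "\<phi> (c *\<^sub>C x) y = c * \<phi> x y" "\<phi> x (c *\<^sub>C y) = c * \<phi> x y"
  using bilinear by (simp_all add: cbilinear_def clinear_iff)

lemma clinear_cocycle: "clinear (\<phi> x)" "clinear (\<lambda>x. \<phi> x y)"
  by (simp_all add: clinear_iff cocycle_add_scale)

lemma clinear_cocycle_antipode: "clinear (\<lambda>y. \<phi> x (S y))" "clinear (\<lambda>x. \<phi> (S x) y)"
  by (simp_all add: clinear_iff cocycle_add_scale)

text \<open>The cocycle identity is summed over the triple with \<open>S\<close> applied to its
  middle leg. Normalisation kills the two terms containing a product, and the other two are the
  sides of the claim.\<close>

lemma sweedler_cocycle_antipode:
  "sweedler (\<lambda>x y. \<phi> (S x) y) a = sweedler (\<lambda>x y. \<phi> x (S y)) a"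
proof -
  note tri = ctrilinear_def cbilinear_def clinear_iff cocycle_add_scale algebra_simps
  have t1: "ctrilinear (\<lambda>x y z. \<phi> (x * S y) z)" and t2: "ctrilinear (\<lambda>x y z. \<phi> x (S y) * \<epsilon> z)"
    by (simp_all add: tri)
  have lin: "clinear (sweedler (\<lambda>x y. \<phi> (S x) y))"
    by (rule clinear_sweedler) (simp add: tri)
  have lin': "clinear (sweedler (\<lambda>x y. \<phi> x (S y)))"
    by (rule clinear_sweedler) (simp add: tri)
  have zero: "tensor_lift (\<lambda>x y. 0 :: complex) t = 0" for t :: "('a, 'a) tensor"
    using tensor_lift_fun_times[of 0 "\<lambda>x y. 0" t] by simp
  have 1: "sweedler (\<lambda>x y. sweedler (\<lambda>y z. \<phi> (x * S y) z) y) a = 0"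
    using sweedler_antipode_right[OF clinear_cocycle(2)]
    by (simp add: sweedler_coassoc[OF t1, symmetric] one_left zero)
  have 2: "sweedler (\<lambda>x y. sweedler (\<lambda>y z. \<epsilon> x * \<phi> (S y) z) y) a = sweedler (\<lambda>x y. \<phi> (S x) y) a"
    using sweedler_counit_left[OF lin, of a] by (simp add: tensor_lift_fun)
  have 3: "sweedler (\<lambda>x y. sweedler (\<lambda>y z. \<phi> x (S y * z)) y) a = 0"
    using sweedler_antipode_left[OF clinear_cocycle(1)]
    by (simp add: one_right zero)
  have 4: "sweedler (\<lambda>x y. sweedler (\<lambda>y z. \<phi> x (S y) * \<epsilon> z) y) a = sweedler (\<lambda>x y. \<phi> x (S y)) a"
    using sweedler_counit_right[OF lin', of a]
    unfolding sweedler_coassoc[OF t2, symmetric] by (simp add: tensor_lift_fun mult.commute)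
  have "sweedler (\<lambda>x y. sweedler (\<lambda>y z. \<phi> (x * S y) z - \<epsilon> x * \<phi> (S y) z) y) a =
      sweedler (\<lambda>x y. sweedler (\<lambda>y z. \<phi> x (S y * z) - \<phi> x (S y) * \<epsilon> z) y) a"
    by (simp only: cocycle)
  then show ?thesis
    by (simp only: tensor_lift_fun_diff 1 2 3 4) simp
qed

text \<open>
  The coboundary of \<open>x \<mapsto> - \<phi> (S x\<^sub>(\<^sub>1\<^sub>)) x\<^sub>(\<^sub>2\<^sub>)\<close> is the symmetrisation of \<open>\<phi>\<close> under \<open>S\<close>.
\<close>

lemma sweedler_cocycle_antipode_mult:
  "sweedler (\<lambda>x y. \<phi> (S x) y) (a * b) =
    \<epsilon> a * sweedler (\<lambda>x y. \<phi> (S x) y) b + sweedler (\<lambda>x y. \<phi> (S x) y) a * \<epsilon> b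
    - \<phi> a b - \<phi> (S b) (S a)"
proof -
  have expand: "\<phi> (x * y) z = \<epsilon> x * \<phi> y z + \<phi> x (y * z) - \<phi> x y * \<epsilon> z" for x y z
    using cocycle[of x y z] by (simp add: algebra_simps)
  have expand': "\<phi> x (y * z) = \<phi> (x * y) z - \<epsilon> x * \<phi> y z + \<phi> x y * \<epsilon> z" for x y z
    using cocycle[of x y z] by (simp add: algebra_simps)
  have bil: "cbilinear (\<lambda>x y. \<phi> (S x) y)"
    by (simp add: cbilinear_def clinear_iff cocycle_add_scale)
  have lin: "clinear (\<lambda>w. \<phi> x (y * w))" "clinear (\<lambda>w. \<phi> x (w * y))" for x y
    by (simp_all add: clinear_iff cocycle_add_scale distrib_left distrib_right)
  \<comment> \<open>After \<open>expand'\<close>, the term with \<open>S x * y\<close> vanishes by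
    normalisation and the one with \<open>\<epsilon> (S x)\<close> collapses to
    \<open>\<phi> a b\<close>.\<close>
  have 1: "sweedler (\<lambda>x y. \<phi> (S x) (y * b)) a = sweedler (\<lambda>x y. \<phi> (S x) y) a * \<epsilon> b - \<phi> a b"
    using sweedler_antipode_left[OF clinear_cocycle(2), of b a]
      sweedler_counit_left[OF clinear_cocycle(2), of b a]
    by (simp add: expand' tensor_lift_fun one_left)
  have 2: "sweedler (\<lambda>z w. sweedler (\<lambda>x y. \<phi> (S z) (S x * y * w)) a) b =
      \<epsilon> a * sweedler (\<lambda>z w. \<phi> (S z) w) b"
    using sweedler_antipode_left[OF lin(2)]
    by (simp add: tensor_lift_fun)
  have 3: "sweedler (\<lambda>z w. sweedler (\<lambda>x y. \<phi> (S z) (S x) * (\<epsilon> y * \<epsilon> w)) a) b = \<phi> (S b) (S a)"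
  proof -
    have "sweedler (\<lambda>x y. \<phi> (S z) (S x) * (\<epsilon> y * c)) a = c * \<phi> (S z) (S a)" for z c
      using sweedler_counit_right[OF clinear_cocycle_antipode(1), of "S z" a]
        tensor_lift_fun_times[of c "\<lambda>x y. \<epsilon> y * \<phi> (S z) (S x)" "\<Delta> a"]
      by (simp add: mult_ac)
    then show ?thesis
      using sweedler_counit_right[OF clinear_cocycle_antipode(2), of "S a" b] by simp
  qed
  have "sweedler (\<lambda>x y. \<phi> (S x) y) (a * b) =
      sweedler (\<lambda>x y. sweedler (\<lambda>z w. \<phi> (S z * S x) (y * w)) b) a"
    by (simp add: sweedler_mult[OF bil] antipode_mult)
  also have "\<dots> = sweedler (\<lambda>x y. sweedler (\<lambda>z w. \<epsilon> z * \<phi> (S x) (y * w)) b) a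
      + sweedler (\<lambda>x y. sweedler (\<lambda>z w. \<phi> (S z) (S x * y * w)) b) a
      - sweedler (\<lambda>x y. sweedler (\<lambda>z w. \<phi> (S z) (S x) * (\<epsilon> y * \<epsilon> w)) b) a"
    by (simp add: expand[of "S _" "S _"] tensor_lift_fun_add tensor_lift_fun_diff mult.assoc)
  also have "sweedler (\<lambda>x y. sweedler (\<lambda>z w. \<epsilon> z * \<phi> (S x) (y * w)) b) a =
      sweedler (\<lambda>x y. \<phi> (S x) (y * b)) a"
    using sweedler_counit_left[OF lin(1)] by simp
  \<comment> \<open>The sum over \<open>a\<close> has to be innermost for \<open>S x * y\<close> to
    collapse.\<close>
  also have "sweedler (\<lambda>x y. sweedler (\<lambda>z w. \<phi> (S z) (S x * y * w)) b) a =
      \<epsilon> a * sweedler (\<lambda>z w. \<phi> (S z) w) b"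
    by (subst tensor_lift_swap) (rule 2)
  also have "sweedler (\<lambda>x y. sweedler (\<lambda>z w. \<phi> (S z) (S x) * (\<epsilon> y * \<epsilon> w)) b) a = \<phi> (S b) (S a)"
    by (subst tensor_lift_swap) (rule 3)
  finally show ?thesis
    unfolding 1 by simp
qed

end

end


section \<open>The generating functional of a real cocycle\<close>

lemma cinner_add_left: "cinner (x + y) z = cinner x z + cinner y z"
  by (metis cinner_add_right cinner_commute complex_cnj_add)

lemma cinner_scaleC_left: "cinner (c *\<^sub>C x) y = cnj c * cinner x y"
  by (metis cinner_scaleC_right cinner_commute complex_cnj_mult)

lemma representation_adjoint:
  assumes "representation \<pi>"
  shows "cinner (\<pi> (star a) x) y = cinner x (\<pi> a y)"
proof -
  have "\<pi> a \<in> adjointable_ops"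
    using assms by (simp add: representation_def)
  then obtain T where "is_adjoint (\<pi> a) T"
    by (auto simp: adjointable_ops_def)
  then show ?thesis
    using assms adjoint_op_eq by (metis is_adjoint_def representation_def)
qed

theorem theorem2p7:
  fixes \<Delta> :: "'a::complex_star_algebra \<Rightarrow> ('a, 'a) tensor"
    and \<epsilon> :: "'a \<Rightarrow> complex"
    and S \<alpha> \<gamma> S\<alpha> :: "'a \<Rightarrow> 'a"
    and \<eta> :: "'a \<Rightarrow> 'd::pre_hilbert"
  assumes "hopf_star_algebra \<Delta> \<epsilon> S"
    and "admissible_bijection \<Delta> \<alpha>"
    and "\<gamma> = (\<lambda>a. a + \<alpha> a)"
    and "S\<alpha> = S \<circ> \<alpha>"
    and "real_cocycle \<epsilon> S\<alpha> \<eta>"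
  shows "(\<forall>a. tensor_lift (\<lambda>x y. cinner (\<eta> (star (S\<alpha> x))) (\<eta> (\<alpha> y))) (\<Delta> a) =
              tensor_lift (\<lambda>x y. cinner (\<eta> (star (\<alpha> x))) (\<eta> (S\<alpha> y))) (\<Delta> a)) \<and>
         (\<exists>!L. \<forall>a. L (\<gamma> a) = - tensor_lift (\<lambda>x y. cinner (\<eta> (star (S\<alpha> x))) (\<eta> (\<alpha> y))) (\<Delta> a)) \<and>
         (\<forall>L. (\<forall>a. L (\<gamma> a) = - tensor_lift (\<lambda>x y. cinner (\<eta> (star (S\<alpha> x))) (\<eta> (\<alpha> y))) (\<Delta> a)) \<longrightarrow>
              generating_functional \<epsilon> L \<and> L \<circ> S\<alpha> = L \<and> yields_coboundary \<epsilon> \<eta> L)"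
proof -
  interpret hopf_star_algebra \<Delta> \<epsilon> S by fact
  have hom: "algebra_hom \<alpha>"
    and involutive: "\<alpha> (star (\<alpha> (star a))) = a"
    and comult: "tensor_map \<alpha> \<alpha> (\<Delta> a) = \<Delta> (\<alpha> a)"
    and bij: "bij \<gamma>"
    and bij2: "bij (\<lambda>t :: ('a, 'a) tensor. t + tensor_map \<alpha> \<alpha> t)" for a
    using assms(2) unfolding assms(3)
    by (simp_all add: admissible_bijection_def fun_eq_iff tensor_map_id)
  have \<alpha>_add: "\<alpha> (a + b) = \<alpha> a + \<alpha> b" and \<alpha>_scaleC: "\<alpha> (c *\<^sub>C a) = c *\<^sub>C \<alpha> a"
    and \<alpha>_mult: "\<alpha> (a * b) = \<alpha> a * \<alpha> b" and \<alpha>_lin: "clinear \<alpha>" for a b c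
    using hom by (simp_all add: algebra_hom_def clinear_iff)
  have \<alpha>_star: "\<alpha> (star (\<alpha> a)) = star a" for a
    using involutive[of "star a"] by simp
  \<comment> \<open>The composite of \<alpha>, \<open>star\<close> and \<alpha> is the injective map
    \<open>star\<close>. Injectivity gives the compatibility of \<alpha> with \<epsilon> and
    \<open>S\<close>.\<close>
  have inj: "inj \<alpha>"
    by (rule injI) (metis \<alpha>_star star_star)
  note \<epsilon>_\<alpha> = counit_comult_hom[OF \<alpha>_lin inj comult]
  note S_\<alpha> = antipode_comult_hom[OF hom inj comult]

  have \<eta>_lin: "clinear \<eta>"
    and real: "cinner (\<eta> a) (\<eta> b) = cinner (\<eta> (star (S (\<alpha> b)))) (\<eta> (S (\<alpha> (star a))))" for a b
    using assms(4,5) by (auto simp: real_cocycle_def cocycle_def)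
  obtain \<pi> where \<pi>: "representation \<pi>" and \<eta>_mult: "\<eta> (a * b) = \<pi> a (\<eta> b) + \<epsilon> b *\<^sub>C \<eta> a" for a b
    using assms(5) by (auto simp: real_cocycle_def cocycle_def)
  have \<eta>_one: "\<eta> 1 = 0"
    using \<eta>_mult[of 1 1] \<pi> by (simp add: representation_def)

  \<comment> \<open>The star offsets the conjugate-linearity of the first slot.\<close>
  define \<phi> where "\<phi> x y = cinner (\<eta> (star x)) (\<eta> y)" for x y
  have \<phi>_bil: "cbilinear \<phi>"
    using \<eta>_lin by (simp add: \<phi>_def cbilinear_def clinear_iff star_add star_scaleC
        cinner_add_left cinner_add_right cinner_scaleC_left cinner_scaleC_right)
  then have \<phi>_lin: "\<phi> (x + x') y = \<phi> x y + \<phi> x' y" "\<phi> x (y + y') = \<phi> x y + \<phi> x y'"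
    "\<phi> (c *\<^sub>C x) y = c * \<phi> x y" "\<phi> x (c *\<^sub>C y) = c * \<phi> x y" for x x' y y' c
    by (simp_all add: cbilinear_def clinear_iff)
  \<comment> \<open>Both sides equal
    \<open>cinner (\<eta> (star x)) (\<pi> y (\<eta> z))\<close>.\<close>
  have \<phi>_cocycle: "\<phi> (x * y) z - \<epsilon> x * \<phi> y z = \<phi> x (y * z) - \<phi> x y * \<epsilon> z" for x y z
    by (simp add: \<phi>_def star_mult \<eta>_mult cinner_add_left cinner_add_right cinner_scaleC_left
        cinner_scaleC_right representation_adjoint[OF \<pi>])
  have \<phi>_one: "\<phi> 1 x = 0" "\<phi> x 1 = 0" for x
    using cinner_scaleC_left[of 0 0 "\<eta> x"] cinner_scaleC_right[of "\<eta> (star x)" 0 0]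
    by (simp_all add: \<phi>_def star_one \<eta>_one)
  have \<phi>_real: "\<phi> x y = \<phi> (S (\<alpha> y)) (S (\<alpha> x))" for x y
    by (simp add: \<phi>_def real[of "star x"])
  have \<phi>_star: "cnj (\<phi> x y) = \<phi> (star y) (star x)" for x y
    by (simp add: \<phi>_def cinner_commute[of "\<eta> y"])
  note cocycle = \<phi>_bil \<phi>_cocycle \<phi>_one

  define f where "f = tensor_lift (\<lambda>x y. \<phi> (S x) y) \<circ> \<Delta>"
  have f_bil: "cbilinear (\<lambda>x y. \<phi> (S x) y)" "cbilinear (\<lambda>x y. \<phi> x (S y))"
    by (simp_all add: cbilinear_def clinear_iff \<phi>_lin)
  have f_lin: "clinear f"
    unfolding f_def comp_def by (rule clinear_sweedler[OF f_bil(1)])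
  have f_mult: "f (a * b) = \<epsilon> a * f b + f a * \<epsilon> b - \<phi> a b - \<phi> (S b) (S a)" for a b
    unfolding f_def comp_def by (rule sweedler_cocycle_antipode_mult[OF cocycle])
  have f_left: "tensor_lift (\<lambda>x y. cinner (\<eta> (star (S\<alpha> x))) (\<eta> (\<alpha> y))) (\<Delta> a) = f (\<alpha> a)" for a
    by (simp add: f_def sweedler_comult_hom[OF \<alpha>_lin comult f_bil(1)]) (simp add: \<phi>_def assms(4))
  have f_right: "tensor_lift (\<lambda>x y. \<phi> (\<alpha> x) (S (\<alpha> y))) (\<Delta> a) = f (\<alpha> a)" for a
    unfolding f_def comp_def sweedler_cocycle_antipode[OF cocycle]
    by (rule sweedler_comult_hom[OF \<alpha>_lin comult f_bil(2), symmetric])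
  have f_star: "cnj (f (star a)) = f (\<alpha> a)" for a
  proof -
    \<comment> \<open>Reality applies \<open>S\<close> and \<alpha>, which commute, to the second
      argument, and \<open>antipode_star\<close> cancels there. Summation gives the second form of
      \<open>f (\<alpha> a)\<close>.\<close>
    have "\<phi> y (star (S (star x))) = \<phi> (\<alpha> x) (S (\<alpha> y))" for x y
      by (subst \<phi>_real) (simp add: S_\<alpha> antipode_star)
    then show ?thesis
      using tensor_lift_star[OF f_bil(1), of cnj "\<Delta> a"] f_right[of a]
      by (simp add: f_def comult_star \<phi>_star)
  qed

  have "generating_functional \<epsilon> L \<and> L \<circ> S\<alpha> = L \<and> yields_coboundary \<epsilon> \<eta> L"
    if L: "\<And>a. L (\<gamma> a) = - f (\<alpha> a)" for L
  proof -
    \<comment> \<open>Nothing but the values of \<open>L\<close> on the range of \<gamma> is given;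
      linearity is transported along the linear bijection \<gamma>.\<close>
    have L_lin: "clinear L"
    proof (rule clinearI)
      fix x y c
      obtain a b where xy: "x = \<gamma> a" "y = \<gamma> b"
        using bij by (metis bij_pointE)
      have "x + y = \<gamma> (a + b)" "c *\<^sub>C x = \<gamma> (c *\<^sub>C a)"
        by (simp_all add: xy assms(3) \<alpha>_add \<alpha>_scaleC scaleC_add_right)
      then show "L (x + y) = L x + L y" "L (c *\<^sub>C x) = c *\<^sub>C L x"
        using f_lin by (simp_all add: L \<alpha>_add \<alpha>_scaleC xy clinear_iff)
    qed
    then have L_add: "L (x + y) = L x + L y" and L_scaleC: "L (c *\<^sub>C x) = c * L x" for x y c
      by (simp_all add: clinear_iff)
    have L_\<alpha>: "L a + L (\<alpha> a) = - f (\<alpha> a)" for a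
      using L[of a] by (simp add: assms(3) L_add)

    text \<open>The defect of the coboundary equation is anti-invariant under \<open>\<alpha> \<otimes> \<alpha>\<close>, hence zero.\<close>
    define B where "B x y = L (x * y) - \<epsilon> x * L y - L x * \<epsilon> y - \<phi> x y" for x y
    have B_bil: "cbilinear B"
      by (simp add: cbilinear_def clinear_iff B_def L_add L_scaleC \<phi>_lin algebra_simps)
    have anti: "B x y + B (\<alpha> x) (\<alpha> y) = 0" for x y
    proof -
      \<comment> \<open>Pairing each value of \<open>L\<close> with its \<alpha>-image lets
        \<open>L_\<alpha>\<close> replace all of them by \<open>f\<close>. Then
        \<open>f_mult\<close> leaves only values of \<phi>, which cancel by reality.\<close>
      have "B x y + B (\<alpha> x) (\<alpha> y) = (L (x * y) + L (\<alpha> (x * y))) - \<epsilon> x * (L y + L (\<alpha> y))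
          - (L x + L (\<alpha> x)) * \<epsilon> y - \<phi> x y - \<phi> (\<alpha> x) (\<alpha> y)"
        by (simp add: B_def \<epsilon>_\<alpha> \<alpha>_mult algebra_simps)
      then show ?thesis
        using L_\<alpha>[of "x * y"] L_\<alpha>[of x] L_\<alpha>[of y] \<phi>_real[of x y]
        by (simp add: \<alpha>_mult f_mult \<epsilon>_\<alpha>)
    qed
    have "tensor_lift B (t + tensor_map \<alpha> \<alpha> t) = 0" for t
    proof -
      have "tensor_lift B (t + tensor_map \<alpha> \<alpha> t) = tensor_lift (\<lambda>x y. B x y + B (\<alpha> x) (\<alpha> y)) t"
        by (simp add: clinear_add[OF clinear_tensor_lift[OF B_bil]]
            tensor_lift_tensor_map[OF \<alpha>_lin \<alpha>_lin B_bil] tensor_lift_fun_add)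
      then show ?thesis
        by (simp add: anti tensor_lift_def free_extend_def split_beta)
    qed
    \<comment> \<open>Every tensor has the form just treated, by surjectivity of
      \<open>id \<otimes> id + \<alpha> \<otimes> \<alpha>\<close>.\<close>
    then have "tensor_lift B t = 0" for t
      using bij2 by (metis bij_pointE)
    then have "B x y = 0" for x y
      using tensor_lift_pure[OF B_bil, of x y] by simp
    then have coboundary: "L (x * y) = \<epsilon> x * L y + L x * \<epsilon> y + \<phi> x y" for x y
      by (simp add: B_def algebra_simps)

    have L_one: "L 1 = 0"
      using coboundary[of 1 1] by (simp add: \<phi>_one)
    have L_S: "L a + L (S a) + f a = 0" for a
    proof -
      have "clinear (\<lambda>x. L (S x))"
        by (simp add: clinear_iff L_add L_scaleC)
      then have "L a + L (S a) + f a =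
          tensor_lift (\<lambda>x y. \<epsilon> x * L y + \<epsilon> y * L (S x) + \<phi> (S x) y) (\<Delta> a)"
        using sweedler_counit_left[OF L_lin, of a] sweedler_counit_right[of "\<lambda>x. L (S x)" a]
        by (simp add: tensor_lift_fun_add f_def)
      also have "\<dots> = tensor_lift (\<lambda>x y. L (S x * y)) (\<Delta> a)"
        by (simp add: coboundary mult.commute)
      finally show ?thesis
        by (simp add: sweedler_antipode_left[OF L_lin] L_one)
    qed
    have invariant: "L (S (\<alpha> a)) = L a" for a
      using L_S[of "\<alpha> a"] L_\<alpha>[of a] by algebra
    have hermitian: "L (star b) = cnj (L b)" for b
    proof -
      obtain a where b: "b = \<gamma> a"
        using bij by (metis bij_pointE)
      \<comment> \<open>Since \<alpha> maps \<open>star (\<alpha> a)\<close> to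
        \<open>star a\<close>, the two summands of \<open>star (\<gamma> a)\<close> merely change
        places.\<close>
      have "star b = \<gamma> (star (\<alpha> a))"
        by (simp add: b assms(3) \<alpha>_star star_add add.commute)
      then have "L (star b) = - f (star a)"
        by (simp add: L \<alpha>_star)
      also have "\<dots> = cnj (L b)"
        by (simp add: b L flip: f_star)
      finally show ?thesis .
    qed
    have "L (star a * a) \<in> \<real>\<^sub>\<ge>\<^sub>0" if "\<epsilon> a = 0" for a
      using that cinner_nonneg[of "\<eta> a"] by (simp add: coboundary \<phi>_def)
    then have "generating_functional \<epsilon> L"
      using L_lin hermitian L_one by (simp add: generating_functional_def)
    moreover have "L \<circ> S\<alpha> = L"
      by (simp add: fun_eq_iff assms(4) invariant)
    moreover have "yields_coboundary \<epsilon> \<eta> L"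
      using coboundary by (simp add: yields_coboundary_def \<phi>_def)
    ultimately show ?thesis by blast
  qed
  moreover have "\<exists>!L. \<forall>a. L (\<gamma> a) = - f (\<alpha> a)"
  proof (rule ex1I)
    show "\<forall>a. (\<lambda>b. - f (\<alpha> (inv \<gamma> b))) (\<gamma> a) = - f (\<alpha> a)"
      using bij by (simp add: bij_is_inj)
    show "L = (\<lambda>b. - f (\<alpha> (inv \<gamma> b)))" if "\<forall>a. L (\<gamma> a) = - f (\<alpha> a)" for L
    proof
      fix b
      show "L b = - f (\<alpha> (inv \<gamma> b))"
        using that[rule_format, of "inv \<gamma> b"] by (simp add: surj_f_inv_f[OF bij_is_surj[OF bij]])
    qed
  qed
  moreover have "tensor_lift (\<lambda>x y. cinner (\<eta> (star (\<alpha> x))) (\<eta> (S\<alpha> y))) (\<Delta> a) = f (\<alpha> a)" for a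
    using f_right[of a] by (simp add: \<phi>_def assms(4))
  ultimately show ?thesis
    by (simp only: f_left) blast
qed

end
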